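(* Let $G$ be an abelian group (written additively) and let $g:V\times V\to G$ be any weight function. For every walk $w$ in $Q_3$, $$R_g(w)=\sum_{(p,q)\in V\times V}\tau_w(p,q)\,g(p,q).$$ Consequently, if $u,v$ are walks with $\tau_u=\tau_v$, then $R_g(u)=R_g(v)$ for every abelian group $G$ and every weight function $g:V\times V\to G$.
   Context: $Q_3$ is the $1$-skeleton (graph) of the three-dimensional cube, with vertex set $V=\{0,1\}^3$ and coordinates numbered $0,1,2$; two vertices are adjacent iff they differ in exactly one coordinate. A step in direction $i$ flips the $i$-th coordinate. The basepoint is $o=000$. A walk is $w=(o;a_1a_2\cdots a_n)$ with $n\ge 0$ and $a_k\in\{0,1,2\}$; its vertex sequence is $v_0=o,v_1,\ldots,v_n$, where $v_k$ is obtained from $v_{k-1}$ by flipping coordinate $a_k$. For a weight function $g:V\times V\to G$ and a walk $w$ with vertex sequence $(v_0,\ldots,v_n)$, the additive one-step reading is $R_g(w)=\sum_{k=1}^{n}g(v_{k-1},v_k)$. The directed transition count is the function $\tau_w:V\times V\to\mathbb N$, $\tau_w(p,q)=\#\{k: 1\le k\le n,\ (v_{k-1},v_k)=(p,q)\}$. *)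

theory Defs
  imports "HOL-Analysis.Finite_Cartesian_Product" "HOL-Library.Numeral_Type"
begin

text \<open>
  The coordinate values 0 and 1 are encoded as \<open>False\<close> and \<open>True\<close>. The index type \<^typ>\<open>3\<close> has
  exactly the elements 0, 1, 2, so the vertex set is the whole (finite) type \<open>bool ^ 3\<close>.
\<close>

type_synonym vertex = "bool ^ 3"

type_synonym direction = "3"

definition basepoint :: vertex where
  "basepoint = (\<chi> i. False)"

definition adjacent :: "vertex \<Rightarrow> vertex \<Rightarrow> bool" where
  "adjacent p q \<longleftrightarrow> card {i. p $ i \<noteq> q $ i} = 1"

definition flip :: "direction \<Rightarrow> vertex \<Rightarrow> vertex" where
  "flip i p = (\<chi> j. if j = i then \<not> p $ j else p $ j)"

lemma adjacent_iff_flip: "adjacent p q \<longleftrightarrow> (\<exists>i. q = flip i p)"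
proof
  assume "adjacent p q"
  then obtain i where "{j. p $ j \<noteq> q $ j} = {i}"
    unfolding adjacent_def by (rule card_1_singletonE)
  then have i: "p $ j \<noteq> q $ j \<longleftrightarrow> j = i" for j by blast
  have "q $ j = flip i p $ j" for j
    using i[of j] by (auto simp: flip_def)
  then show "\<exists>i. q = flip i p" unfolding vec_eq_iff by blast
next
  assume "\<exists>i. q = flip i p"
  then obtain i where q: "q = flip i p" ..
  have "p $ j \<noteq> q $ j \<longleftrightarrow> j = i" for j
    by (simp add: q flip_def)
  then have "{j. p $ j \<noteq> q $ j} = {i}" by blast
  then show "adjacent p q" by (simp add: adjacent_def)
qed

text \<open>
  All walks start at the basepoint, so a walk is given by its word of directions
  \<open>[a\<^sub>1, \<dots>, a\<^sub>n]\<close>. Lists are indexed from 0, so \<open>a\<^sub>k\<^sub>+\<^sub>1\<close> is \<open>w ! k\<close>.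
\<close>

type_synonym walk = "direction list"

text \<open>The value \<open>walk_vertex w k\<close> is meaningful only for \<open>k \<le> length w\<close>.\<close>

primrec walk_vertex :: "walk \<Rightarrow> nat \<Rightarrow> vertex" where
  "walk_vertex w 0 = basepoint"
| "walk_vertex w (Suc k) = flip (w ! k) (walk_vertex w k)"

definition reading :: "(vertex \<times> vertex \<Rightarrow> 'g::ab_group_add) \<Rightarrow> walk \<Rightarrow> 'g" where
  "reading g w = (\<Sum>k = 1..length w. g (walk_vertex w (k - 1), walk_vertex w k))"

definition transition_count :: "walk \<Rightarrow> vertex \<times> vertex \<Rightarrow> nat" where
  "transition_count w e =
     card {k. 1 \<le> k \<and> k \<le> length w \<and> (walk_vertex w (k - 1), walk_vertex w k) = e}"

primrec nat_mult :: "nat \<Rightarrow> 'g::ab_group_add \<Rightarrow> 'g"  (infixr \<open>\<cdot>\<close> 75) where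
  "0 \<cdot> x = 0"
| "Suc n \<cdot> x = x + n \<cdot> x"

end

theory Submission
  imports Defs
begin

text \<open>
  The reading of a walk is a sum over its steps. Grouping the steps by the ordered pair of vertices
  they traverse collects, for each pair \<open>e\<close>, as many copies of \<open>g e\<close> as the transition count of \<open>e\<close>;
  commutativity of the group is what permits the regrouping. The reading is thus a function of \<open>g\<close>
  and the transition counts alone, which gives the second claim.
\<close>

lemma sum_const_eq_nat_mult:
  assumes "finite A"
  shows "(\<Sum>k\<in>A. x) = card A \<cdot> x"
  using assms by (induction A rule: finite_induct) simp_all

lemma reading_eq_sum_transition_count:
  "reading g w = (\<Sum>e\<in>UNIV. transition_count w e \<cdot> g e)"
proof -
  define step where "step k = (walk_vertex w (k - 1), walk_vertex w k)" for k
  have "reading g w = (\<Sum>k\<in>{1..length w}. g (step k))"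
    by (simp add: reading_def step_def)
  also have "\<dots> = (\<Sum>e\<in>UNIV. \<Sum>k\<in>{k\<in>{1..length w}. step k = e}. g (step k))"
    by (rule sum.group [symmetric]) simp_all
  also have "\<dots> = (\<Sum>e\<in>UNIV. transition_count w e \<cdot> g e)"
  proof (rule sum.cong [OF refl])
    fix e
    have "{k\<in>{1..length w}. step k = e}
        = {k. 1 \<le> k \<and> k \<le> length w \<and> (walk_vertex w (k - 1), walk_vertex w k) = e}"
      by (auto simp: step_def)
    then have "transition_count w e = card {k\<in>{1..length w}. step k = e}"
      by (simp only: transition_count_def)
    then show "(\<Sum>k\<in>{k\<in>{1..length w}. step k = e}. g (step k)) = transition_count w e \<cdot> g e"
      by (simp add: sum_const_eq_nat_mult [symmetric])
  qed
  finally show ?thesis .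
qed

theorem proposition3p2:
  shows "(\<forall>(g :: vertex \<times> vertex \<Rightarrow> 'g::ab_group_add) (w :: walk).
            reading g w = (\<Sum>(p, q) \<in> UNIV \<times> UNIV. transition_count w (p, q) \<cdot> g (p, q))) \<and>
         (\<forall>(u :: walk) (v :: walk). transition_count u = transition_count v \<longrightarrow>
            (\<forall>g :: vertex \<times> vertex \<Rightarrow> 'g. reading g u = reading g v))"
  by (simp add: reading_eq_sum_transition_count case_prod_unfold)

end
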